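(* Assume $d\ge3$. Every $\rho\in\mathfrak M_d$ satisfies $\operatorname{tr}\Sigma(\rho)\le K_d\,\chi_*(\rho)$; hence $\sup_{\rho\in\mathfrak M_d:\chi_*(\rho)\le C}\operatorname{tr}\Sigma(\rho)\le K_dC$ for all $C\ge0$. If $0\le C\le C_*(d)$, this bound is attained by $\rho_{p,\lambda_*}$ with $p=C/C_*(d)$, and $\rho_{p,\lambda_*}$ is the unique $\rho\in\mathfrak M_d$ with $\chi_*(\rho)\le C$ and $\operatorname{tr}\Sigma(\rho)=K_dC$.
   Context: Fix $d\ge3$. Let $H\in\mathbb R^{d\times(d-1)}$ have orthonormal columns spanning $\{u\in\mathbb R^d:\mathbf 1^\top u=0\}$, $\gamma_i:=H^\top e_i$, $\mathcal X_d:=\{x\in\mathbb R^{d-1}:1+\gamma_i^\top x\ge0\ \forall i\}$. An anchored law is a Borel probability measure $\rho$ on $\mathcal X_d$ with $\int x\,\rho(dx)=0$; $\mathfrak M_d$ is the set of anchored laws; $\Sigma(\rho):=\int xx^\top\rho(dx)$. Budget: $\chi_*(\rho):=\max_{i\ne j}\int\frac{((\gamma_j-\gamma_i)^\top x)^2}{1+\gamma_i^\top x}\rho(dx)$, with the integrand $0$ where $1+\gamma_i^\top x=0=(\gamma_j-\gamma_i)^\top x$ and $+\infty$ where $1+\gamma_i^\top x=0\ne(\gamma_j-\gamma_i)^\top x$. Augmented randomized response: for $\lambda>1$, $p\in[0,1]$, $t_\lambda:=\frac{d(\lambda-1)}{d+\lambda-1}$ and $\rho_{p,\lambda}:=(1-p)\delta_0+\frac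 pd\sum_{i=1}^d\delta_{t_\lambda\gamma_i}$. Put $\lambda_*:=\sqrt{d-1}$, $C_1(\lambda):=\frac{(\lambda-1)^2(\lambda+1)}{\lambda(d+\lambda-1)}$, $C_*(d):=C_1(\lambda_* )$, $K_d:=\frac{d(d-1)}{d+2\sqrt{d-1}}$. *)

theory Defs
  imports "HOL-Probability.Probability"
begin

text \<open>The matrix H is d x (d-1): rows indexed by 'n (CARD('n) = d), columns by 'm (CARD('m) = d-1).\<close>

definition valid_H :: "real^'m^'n \<Rightarrow> bool" where
  "valid_H H \<longleftrightarrow> transpose H ** H = mat 1 \<and>
     span (columns H) = {u :: real^'n. (\<Sum>k\<in>UNIV. u $ k) = 0}"

definition gam :: "real^'m^'n \<Rightarrow> 'n \<Rightarrow> real^'m" where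
  "gam H i = transpose H *v axis i 1"

definition Xd :: "real^'m^'n \<Rightarrow> (real^'m) set" where
  "Xd H = {x. \<forall>i. 1 + gam H i \<bullet> x \<ge> 0}"

definition anchored :: "real^'m^'n \<Rightarrow> (real^'m) measure set" where
  "anchored H = {\<rho>. prob_space \<rho> \<and> sets \<rho> = sets borel \<and> emeasure \<rho> (Xd H) = 1 \<and>
      integrable \<rho> (\<lambda>x. x) \<and> integral\<^sup>L \<rho> (\<lambda>x. x) = 0}"

definition Sigma_mat :: "(real^'m) measure \<Rightarrow> real^'m^'m" where
  "Sigma_mat \<rho> = (\<chi> a b. integral\<^sup>L \<rho> (\<lambda>x. x $ a * x $ b))"

definition chi_integrand :: "real^'m^'n \<Rightarrow> 'n \<Rightarrow> 'n \<Rightarrow> real^'m \<Rightarrow> ennreal" where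
  "chi_integrand H i j x =
     (if 1 + gam H i \<bullet> x = 0
      then (if (gam H j - gam H i) \<bullet> x = 0 then 0 else \<infinity>)
      else ennreal (((gam H j - gam H i) \<bullet> x)\<^sup>2 / (1 + gam H i \<bullet> x)))"

definition chi_star :: "real^'m^'n \<Rightarrow> (real^'m) measure \<Rightarrow> ennreal" where
  "chi_star H \<rho> = Max {(\<integral>\<^sup>+ x. chi_integrand H i j x \<partial>\<rho>) | i j. i \<noteq> j}"

definition t_lam :: "real \<Rightarrow> real \<Rightarrow> real" where
  "t_lam d lam = d * (lam - 1) / (d + lam - 1)"

definition rho_rr :: "real^'m^'n \<Rightarrow> real \<Rightarrow> real \<Rightarrow> (real^'m) measure" where
  "rho_rr H p lam = measure_of UNIV (sets borel)
     (\<lambda>A. ennreal (1 - p) * indicator A 0 +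
          ennreal (p / real CARD('n)) *
            (\<Sum>i\<in>UNIV. indicator A (t_lam (real CARD('n)) lam *\<^sub>R gam H i)))"

definition lam_star :: "real \<Rightarrow> real" where
  "lam_star d = sqrt (d - 1)"

definition C1 :: "real \<Rightarrow> real \<Rightarrow> real" where
  "C1 d lam = (lam - 1)\<^sup>2 * (lam + 1) / (lam * (d + lam - 1))"

definition C_star :: "real \<Rightarrow> real" where
  "C_star d = C1 d (lam_star d)"

definition K_d :: "real \<Rightarrow> real" where
  "K_d d = d * (d - 1) / (d + 2 * sqrt (d - 1))"

end

(*
  Put z_i = 1 + gamma_i . x, so that z_i >= 0, sum z_i = d and |x|^2 = sum z_i^2 - d.  Averaging the
  budget integrals over all ordered pairs of distinct i, j reduces the trace bound to the pointwise inequality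
    (S - d) (d + 2 s) <= S R - d^2,   S = sum z_i^2,  R = sum 1 / z_i,  s = sqrt (d - 1).
  For the latter let a be the largest z_i, b the mean of the others and V the sum of (z_i - b)^2 over
  them.  Since 1 / z >= 2 / b - z / b^2 + (z - b)^2 / (a b^2) for 0 < z <= a, the inequality reduces to
  a quadratic in V with nonnegative coefficients, whose constant term is s^2 (a - b)^2 (a - s b)^2 / (a b d).
  Equality forces either z = 1 or z_k = s z_i for one k and all i distinct from k, where the other z_i
  coincide; so an extremal law lives on 0 and the points t gamma_k.  Its zero mean makes the weights of
  the t gamma_k equal, and the trace fixes their common value.
*)
theory Submission
  imports Defs
begin

section \<open>The pointwise inequality on the simplex and its equality cases\<close>

text \<open>\<open>E\<close> is the slack \<open>S * R - d\<^sup>2 - (S - d) * (d + 2 * s)\<close>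
  with \<open>R\<close> replaced by its lower bound: for d = s^2 + 1 one has d + 2 s = (s + 1)^2,
  and the terms free of S and R leave 2 d s. As a quadratic in \<open>V\<close> it has nonnegative
  coefficients \<open>E0\<close>, \<open>G\<close> and 1 / (a b^2), so \<open>E = 0\<close> makes
  every term vanish.\<close>

lemma two_value_bound:
  fixes a b s V :: real
  assumes b: "0 < b" "b \<le> a" and s: "1 \<le> s" and V: "0 \<le> V"
    and sum: "a + s\<^sup>2 * b = s\<^sup>2 + 1"
  defines "E \<equiv> (a\<^sup>2 + s\<^sup>2 * b\<^sup>2 + V) * (1 / a + s\<^sup>2 / b + V / (a * b\<^sup>2) - (s + 1)\<^sup>2)
                + 2 * (s\<^sup>2 + 1) * s"
  shows "0 \<le> E" and "E = 0 \<Longrightarrow> V = 0 \<and> (a = b \<or> a = s * b)"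
proof -
  define d where "d = s\<^sup>2 + 1"
  define E0 where "E0 = (a\<^sup>2 + s\<^sup>2 * b\<^sup>2) * (1 / a + s\<^sup>2 / b - (s + 1)\<^sup>2) + 2 * d * s"
  define G where "G = 1 / a + s\<^sup>2 / b + (a\<^sup>2 + s\<^sup>2 * b\<^sup>2) / (a * b\<^sup>2) - (s + 1)\<^sup>2"
  have a: "0 < a" and d: "0 < d" using b by (auto simp: d_def add_nonneg_pos)
  have aeq: "a = s\<^sup>2 + 1 - s\<^sup>2 * b" using sum by simp
  have E: "E = E0 + V * G + V\<^sup>2 / (a * b\<^sup>2)"
    unfolding E_def E0_def G_def d_def using a b by (simp add: field_simps power2_eq_square)
  \<comment> \<open>The factor d homogenises: modulo a + s^2 b = d the right side is a quartic form
    in a and b, with double roots at a = b and a = s b.\<close>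
  have "a * b * d * E0 = d * ((a\<^sup>2 + s\<^sup>2 * b\<^sup>2) * (b + s\<^sup>2 * a - (s + 1)\<^sup>2 * a * b) + 2 * d * s * a * b)"
    unfolding E0_def using a b by (simp add: field_simps power2_eq_square)
  also have "\<dots> = s\<^sup>2 * ((a - b) * (a - s * b))\<^sup>2"
    unfolding d_def aeq by algebra
  finally have E0': "E0 = s\<^sup>2 * ((a - b) * (a - s * b))\<^sup>2 / (a * b * d)"
    using a b d by (simp add: field_simps)
  then have E0: "0 \<le> E0" using a b d by simp
  have "a * b\<^sup>2 * d * G = (a + s\<^sup>2 * b) * (d * b\<^sup>2 + s\<^sup>2 * a * b + a\<^sup>2) - d * (s + 1)\<^sup>2 * a * b\<^sup>2"
    unfolding G_def sum d_def[symmetric] using a b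
    by (simp add: field_simps power2_eq_square) (simp add: d_def algebra_simps power2_eq_square)
  \<comment> \<open>Completing the square in a leaves squares with nonnegative weights, plus one
    term that needs b \<le> a.\<close>
  also have "\<dots> = a * (a\<^sup>2 - b\<^sup>2) + a * b\<^sup>2 * (s - 1)\<^sup>2
      + s\<^sup>2 * b * (2 * (a - (s + 1) * b / 2)\<^sup>2 + (s - 1)\<^sup>2 * b\<^sup>2 / 2)"
    unfolding d_def by (simp add: field_simps power2_eq_square)
  also have "\<dots> \<ge> 0"
    using a b by (intro add_nonneg_nonneg mult_nonneg_nonneg) (auto simp: power_mono)
  finally have "0 \<le> a * b\<^sup>2 * d * G" .
  moreover have "0 < a * b\<^sup>2 * d" using a b d by simp
  ultimately have G: "0 \<le> G" by (simp only: zero_le_mult_iff) linarith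
  have V2: "0 \<le> V\<^sup>2 / (a * b\<^sup>2)" using a by simp
  show "0 \<le> E" unfolding E using E0 G V V2 by simp
  assume "E = 0"
  then have "E0 = 0" "V\<^sup>2 / (a * b\<^sup>2) = 0"
    using E E0 V2 mult_nonneg_nonneg[OF V G] by linarith+
  then show "V = 0 \<and> (a = b \<or> a = s * b)"
    using E0' a b d s by auto
qed

text \<open>The largest coordinate a is split off because the minorant of 1 / z used below requires
  z \<le> a on the rest, which then enters only through its mean b and spread V. The values in the
  nontrivial equality case solve a = s b and a + s^2 b = d.\<close>

lemma simplex_inequality:
  fixes z :: "'i \<Rightarrow> real"
  assumes fin: "finite I" and card: "2 \<le> card I"
    and pos: "\<And>i. i \<in> I \<Longrightarrow> 0 < z i" and sum: "sum z I = real (card I)"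
  defines "d \<equiv> real (card I)"
  defines "s \<equiv> sqrt (d - 1)"
  defines "S \<equiv> \<Sum>i\<in>I. (z i)\<^sup>2"
  defines "R \<equiv> \<Sum>i\<in>I. 1 / z i"
  shows "(S - d) * (d + 2 * s) \<le> S * R - d\<^sup>2" (is ?ineq)
    and "S * R - d\<^sup>2 = (S - d) * (d + 2 * s) \<Longrightarrow>
      (\<forall>i\<in>I. z i = 1) \<or>
      (\<exists>k\<in>I. z k = d / (1 + s) \<and> (\<forall>i\<in>I - {k}. z i = d / (s * (1 + s))))"
proof -
  have I: "I \<noteq> {}" using card by auto
  have d2: "2 \<le> d" using card by (simp add: d_def)
  then have s2: "s\<^sup>2 = d - 1" and s1: "1 \<le> s" by (auto simp: s_def)
  obtain k where k: "k \<in> I" and max: "\<And>i. i \<in> I \<Longrightarrow> z i \<le> z k"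
  proof -
    have "Max (z ` I) \<in> z ` I" using fin I by (intro Max_in) auto
    then obtain k where "k \<in> I" "z k = Max (z ` I)" by force
    with fin that show ?thesis by (metis Max_ge finite_imageI imageI)
  qed
  define J where "J = I - {k}"
  have J: "finite J" "J \<noteq> {}" and cardJ: "real (card J) = s\<^sup>2"
  proof -
    show "finite J" using fin by (simp add: J_def)
    have "card J = card I - 1" using k fin by (simp add: J_def)
    then show "real (card J) = s\<^sup>2" using card by (simp add: s2 d_def of_nat_diff)
    with s1 show "J \<noteq> {}" by auto
  qed
  have split: "sum f I = f k + sum f J" for f :: "'i \<Rightarrow> real"
    unfolding J_def using fin k by (rule sum.remove)
  define a where "a = z k"
  define b where "b = sum z J / s\<^sup>2"
  define V where "V = (\<Sum>i\<in>J. (z i - b)\<^sup>2)"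
  have a: "0 < a" using pos k by (simp add: a_def)
  have s0: "0 < s\<^sup>2" using s1 by simp
  have "0 < sum z J" using J pos by (intro sum_pos) (auto simp: J_def)
  then have b: "0 < b" using s0 by (simp add: b_def)
  have sumJ: "sum z J = s\<^sup>2 * b" using s0 by (simp add: b_def)
  have "sum z J \<le> s\<^sup>2 * a"
    using sum_bounded_above[of J z a] max by (auto simp: J_def[symmetric] a_def cardJ) (auto simp: J_def cardJ)
  then have ba: "b \<le> a" using sumJ s0 by simp
  have ab: "a + s\<^sup>2 * b = s\<^sup>2 + 1"
    using split[of z] sum sumJ s2 by (simp add: a_def d_def)
  have "V = (\<Sum>i\<in>J. (z i)\<^sup>2 - 2 * b * z i + b\<^sup>2)"
    unfolding V_def by (intro sum.cong) (auto simp: power2_diff algebra_simps)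
  also have "\<dots> = (\<Sum>i\<in>J. (z i)\<^sup>2) - 2 * b * sum z J + s\<^sup>2 * b\<^sup>2"
    by (simp add: sum.distrib sum_subtractf cardJ flip: sum_distrib_left)
  finally have "V = (\<Sum>i\<in>J. (z i)\<^sup>2) - 2 * b * sum z J + s\<^sup>2 * b\<^sup>2" .
  then have S: "S = a\<^sup>2 + s\<^sup>2 * b\<^sup>2 + V"
    unfolding S_def split sumJ by (simp add: a_def power2_eq_square)
  \<comment> \<open>The tangent line to 1 / z at b has exact remainder (z - b)^2 / (z b^2), which z
    \<le> a bounds from below.\<close>
  have "(\<Sum>i\<in>J. 2 / b - z i / b\<^sup>2 + (z i - b)\<^sup>2 / (a * b\<^sup>2)) \<le> (\<Sum>i\<in>J. 1 / z i)"
  proof (rule sum_mono)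
    fix i assume "i \<in> J"
    then have z: "0 < z i" "z i \<le> a" using pos max by (auto simp: J_def a_def)
    then have "(z i - b)\<^sup>2 / (a * b\<^sup>2) \<le> (z i - b)\<^sup>2 / (z i * b\<^sup>2)"
      using b by (intro divide_left_mono mult_right_mono mult_pos_pos) auto
    also have "\<dots> = 1 / z i - 2 / b + z i / b\<^sup>2"
      using z b by (simp add: field_simps power2_eq_square)
    finally show "2 / b - z i / b\<^sup>2 + (z i - b)\<^sup>2 / (a * b\<^sup>2) \<le> 1 / z i" by simp
  qed
  also have "(\<Sum>i\<in>J. 2 / b - z i / b\<^sup>2 + (z i - b)\<^sup>2 / (a * b\<^sup>2))
      = s\<^sup>2 * (2 / b) - sum z J / b\<^sup>2 + V / (a * b\<^sup>2)"
    by (simp add: sum.distrib sum_subtractf V_def cardJ sum_divide_distrib)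
  also have "\<dots> = s\<^sup>2 / b + V / (a * b\<^sup>2)"
    unfolding sumJ using b by (simp add: field_simps power2_eq_square)
  finally have R: "1 / a + s\<^sup>2 / b + V / (a * b\<^sup>2) \<le> R"
    unfolding R_def split by (simp add: a_def)
  define E where "E = (a\<^sup>2 + s\<^sup>2 * b\<^sup>2 + V) * (1 / a + s\<^sup>2 / b + V / (a * b\<^sup>2) - (s + 1)\<^sup>2)
                + 2 * (s\<^sup>2 + 1) * s"
  have V: "0 \<le> V" by (simp add: V_def sum_nonneg)
  note E = two_value_bound[OF b ba s1 V ab, folded E_def]
  have S0: "0 \<le> S" by (simp add: S_def sum_nonneg)
  \<comment> \<open>\<open>S\<close> is exact in a, b, V and nonnegative, so lowering
    \<open>R\<close> can only lower the slack.\<close>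
  have "E \<le> S * (R - (s + 1)\<^sup>2) + 2 * (s\<^sup>2 + 1) * s"
    unfolding E_def S[symmetric] using R S0 by (intro add_right_mono mult_left_mono) auto
  also have "\<dots> = S * R - d\<^sup>2 - (S - d) * (d + 2 * s)"
    using s2 by algebra
  finally have *: "E \<le> S * R - d\<^sup>2 - (S - d) * (d + 2 * s)" .
  then show ?ineq using E(1) by simp
  assume "S * R - d\<^sup>2 = (S - d) * (d + 2 * s)"
  then have "E = 0" using * E(1) by simp
  from E(2)[OF this] have V0: "V = 0" and cases: "a = b \<or> a = s * b" by auto
  from V0 J have zb: "z i = b" if "i \<in> J" for i
    using that by (auto simp: V_def sum_nonneg_eq_0_iff)
  from cases show "(\<forall>i\<in>I. z i = 1) \<or>
      (\<exists>k\<in>I. z k = d / (1 + s) \<and> (\<forall>i\<in>I - {k}. z i = d / (s * (1 + s))))"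
  proof
    assume "a = b"
    with ab have "(s\<^sup>2 + 1) * b = (s\<^sup>2 + 1) * 1" by (simp add: algebra_simps)
    then have "b = 1" using s0 by simp
    with \<open>a = b\<close> zb show ?thesis by (auto simp: J_def a_def)
  next
    assume asb: "a = s * b"
    with ab s2 have "b * (s * (1 + s)) = d" by (simp add: algebra_simps power2_eq_square)
    moreover have "s * (1 + s) \<noteq> 0" using s1 by auto
    ultimately have "b = d / (s * (1 + s))" by (simp add: nonzero_eq_divide_eq)
    moreover from this asb have "a = d / (1 + s)" using s1 by simp
    ultimately show ?thesis using zb k by (auto simp: J_def a_def)
  qed
qed

section \<open>The frame of vectors gamma_i and the pointwise budget bound\<close>

definition offdiag :: "('i \<times> 'i) set" where "offdiag = {(i, j). i \<noteq> j}"

lemma card_offdiag: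
  "real (card (offdiag :: ('i::finite \<times> 'i) set)) = real CARD('i) * (real CARD('i) - 1)"
proof -
  have *: "(offdiag :: ('i \<times> 'i) set) = (SIGMA i:UNIV. UNIV - {i})" by (auto simp: offdiag_def)
  show ?thesis unfolding * by (subst card_SigmaI) (simp_all add: card_Diff_singleton)
qed

text \<open>\<open>s\<close> plays two roles: it is the root in the inequality above and the
  parameter \<open>lam_star d\<close>. \<open>t\<close> is the factor scaling the gamma_k to the
  nonzero atoms of \<open>rho_rr\<close>.\<close>

locale simplex_frame =
  fixes H :: "real^'m^'n" and d s t :: real
  assumes card3: "3 \<le> CARD('n)" and valid: "valid_H H"
    and d_def: "d = real CARD('n)" and s_def: "s = sqrt (d - 1)"
    and t_def: "t = t_lam d (lam_star d)"
begin

abbreviation g :: "'n \<Rightarrow> real^'m" where "g \<equiv> gam H"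

lemma d_eq: "d = s\<^sup>2 + 1" using card3 by (simp add: d_def s_def)

lemma s_gt_1: "1 < s" using card3 by (simp add: d_def s_def)

lemma d_pos: "0 < d" by (simp add: d_def)

lemma vec_mult_frame: "(H *v x) v* H = x"
  using valid by (simp add: valid_H_def matrix_vector_mul_assoc flip: transpose_matrix_vector)

lemma gam_inner_eq: "g i \<bullet> x = (H *v x) $ i"
  by (simp add: gam_def dot_lmul_matrix inner_axis')

lemma sum_mult_vec: "(\<Sum>k\<in>UNIV. (H *v x) $ k) = 0"
  using matrix_vector_mult_in_columnspace[of H x] valid by (simp add: valid_H_def)

lemma sum_gam_inner: "(\<Sum>i\<in>UNIV. g i \<bullet> x) = 0"
  by (simp add: gam_inner_eq sum_mult_vec)

text \<open>Orthonormal columns make H an isometry, and gamma_i . x is the i-th coordinate of H x;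
  this is Parseval's identity for the frame.\<close>

lemma norm_eq_sum_gam: "(norm x)\<^sup>2 = (\<Sum>i\<in>UNIV. (g i \<bullet> x)\<^sup>2)"
proof -
  have "(H *v x) \<bullet> (H *v x) = x \<bullet> x"
    by (metis dot_lmul_matrix vec_mult_frame)
  moreover have "(H *v x) \<bullet> (H *v x) = (\<Sum>i\<in>UNIV. (g i \<bullet> x)\<^sup>2)"
    unfolding gam_inner_eq inner_vec_def[of "H *v x"] by (simp add: power2_eq_square)
  ultimately show ?thesis by (simp add: power2_norm_eq_inner)
qed

lemma gam_eqI: "(\<And>i. g i \<bullet> x = g i \<bullet> y) \<Longrightarrow> x = y"
  using norm_eq_sum_gam[of "x - y"] by (simp add: inner_diff_right)

text \<open>H H^T is the orthogonal projection onto the sum-zero hyperplane, and these are the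
  entries of I - (1/d) 1 1^T.\<close>

lemma gam_inner_gam: "g i \<bullet> g j = (if i = j then 1 else 0) - 1 / d"
proof -
  \<comment> \<open>\<open>w\<close> is the component of e_j along the all-ones vector; H^T
    annihilates it, so gamma_j is the coordinate vector of e_j - w.\<close>
  define w :: "real^'n" where "w = (\<chi> k. 1 / d)"
  let ?u = "axis j 1 - w"
  have "(w v* H) \<bullet> x = 0" for x
    using sum_mult_vec[of x] unfolding dot_lmul_matrix inner_vec_def[of w]
    by (simp add: w_def flip: sum_divide_distrib)
  then have w: "w v* H = 0" using inner_eq_zero_iff by blast
  have "(\<Sum>k\<in>UNIV. ?u $ k) = 0"
    by (simp add: sum_subtractf axis_def w_def d_def)
  \<comment> \<open>Here the columns must span the whole hyperplane, so that e_j - w lies in the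
    range of H.\<close>
  then have "?u \<in> span (columns H)" using valid by (simp add: valid_H_def)
  also have "span (columns H) \<subseteq> range ((*v) H)"
    by (rule span_minimal) (auto simp: columns_image_basis intro: linear_subspace_image)
  finally obtain v where v: "?u = H *v v" by auto
  have "g j = (?u + w) v* H" by (simp add: gam_def)
  also have "\<dots> = v"
    unfolding vector_matrix_left_distrib v by (simp add: w vec_mult_frame)
  finally have "H *v g j = ?u" by (simp add: v)
  then show ?thesis by (simp add: gam_inner_eq axis_def w_def)
qed

lemma norm_gam: "(norm (g i))\<^sup>2 = 1 - 1 / d"
  by (simp add: power2_norm_eq_inner gam_inner_gam)

lemma t_eq: "t = d * (s - 1) / (s * (s + 1))"
proof -
  have "d + s - 1 = s * (s + 1)"
    using d_eq by (simp add: algebra_simps power2_eq_square)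
  then show ?thesis by (simp add: t_def t_lam_def lam_star_def flip: s_def)
qed

lemma t_pos: "0 < t" using s_gt_1 d_pos unfolding t_eq by simp

text \<open>These are the two values of the nontrivial equality case in
  \<open>simplex_inequality\<close>, with coordinate k the large one; their ratio is s, that is,
  \<open>lam_star d\<close>.\<close>

lemma gam_atom:
  "1 + g i \<bullet> (t *\<^sub>R g k) = (if i = k then d / (1 + s) else d / (s * (1 + s)))"
proof -
  have "s * (1 + s) \<noteq> 0" "1 + s \<noteq> 0" "s \<noteq> 0" "s\<^sup>2 + 1 \<noteq> 0"
    using s_gt_1 d_pos d_eq by auto
  then show ?thesis
    unfolding inner_scaleR_right gam_inner_gam t_eq d_eq
    by (auto simp: divide_simps) (auto simp: algebra_simps power2_eq_square)
qed

lemma gam_atom_pos: "0 < 1 + g i \<bullet> (t *\<^sub>R g k)"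
proof -
  have "0 < s" using s_gt_1 by simp
  then show ?thesis unfolding gam_atom using d_pos by (simp add: add_pos_pos)
qed

text \<open>(z_j - z_i)^2 / z_i = z_j^2 / z_i - 2 z_j + z_i, and since the z_i sum to d the linear
  terms give -2 d^2 + d^2. Positivity avoids the degenerate branches of the integrand.\<close>

lemma sum_chi_integrand:
  assumes "\<And>i. 0 < 1 + g i \<bullet> x"
  shows "(\<Sum>(i, j)\<in>offdiag. chi_integrand H i j x) =
    ennreal ((\<Sum>i\<in>UNIV. (1 + g i \<bullet> x)\<^sup>2) * (\<Sum>i\<in>UNIV. 1 / (1 + g i \<bullet> x)) - d\<^sup>2)"
proof -
  define z where "z i = 1 + g i \<bullet> x" for i
  have z: "0 < z i" for i using assms by (simp add: z_def)
  have sz: "sum z UNIV = d" by (simp add: z_def d_def sum.distrib sum_gam_inner)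
  have "chi_integrand H i j x = ennreal ((z j - z i)\<^sup>2 / z i)" for i j
    using z[of i] by (simp add: chi_integrand_def z_def inner_diff_left)
  then have "(\<Sum>(i, j)\<in>offdiag. chi_integrand H i j x)
      = (\<Sum>(i, j)\<in>offdiag. ennreal ((z j - z i)\<^sup>2 / z i))" by simp
  \<comment> \<open>Diagonal terms vanish, so the sum may run over all pairs and factor.\<close>
  also have "\<dots> = (\<Sum>(i, j)\<in>UNIV \<times> UNIV. ennreal ((z j - z i)\<^sup>2 / z i))"
    by (rule sum.mono_neutral_left) (auto simp: offdiag_def)
  also have "\<dots> = ennreal (\<Sum>i\<in>UNIV. \<Sum>j\<in>UNIV. (z j - z i)\<^sup>2 / z i)"
    unfolding sum.cartesian_product[symmetric]
    using z by (simp add: sum_nonneg less_imp_le)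
  also have "(\<Sum>i\<in>UNIV. \<Sum>j\<in>UNIV. (z j - z i)\<^sup>2 / z i)
      = (\<Sum>i\<in>UNIV. \<Sum>j\<in>UNIV. (z j)\<^sup>2 * (1 / z i) - 2 * z j + z i)"
  proof (intro sum.cong refl)
    show "(z j - z i)\<^sup>2 / z i = (z j)\<^sup>2 * (1 / z i) - 2 * z j + z i" for i j
      using z[of i] by (simp add: field_simps power2_eq_square)
  qed
  also have "\<dots> = (\<Sum>j\<in>UNIV. (z j)\<^sup>2) * (\<Sum>i\<in>UNIV. 1 / z i) - d\<^sup>2"
    by (simp only: sum.distrib sum_subtractf sum_distrib_left[symmetric]
        sum_distrib_right[symmetric] sz sum_constant d_def[symmetric])
      (simp add: power2_eq_square)
  finally show ?thesis by (simp add: z_def)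
qed

text \<open>The coordinates sum to d > 0, so some z_j is nonzero; the pair (i, j) then falls into
  the infinite branch.\<close>

lemma sum_chi_integrand_top:
  assumes "1 + g i \<bullet> x = 0"
  shows "(\<Sum>(i, j)\<in>offdiag. chi_integrand H i j x) = \<infinity>"
proof -
  have "\<exists>j. 1 + g j \<bullet> x \<noteq> 0"
  proof (rule ccontr)
    assume "\<nexists>j. 1 + g j \<bullet> x \<noteq> 0"
    then have "(\<Sum>j\<in>UNIV. 1 + g j \<bullet> x) = 0" by simp
    then show False by (simp add: sum.distrib sum_gam_inner)
  qed
  then obtain j where j: "1 + g j \<bullet> x \<noteq> 0" by auto
  then have "chi_integrand H i j x = \<infinity>"
    using assms by (auto simp: chi_integrand_def inner_diff_left)
  moreover have "(i, j) \<in> offdiag" using assms j by (auto simp: offdiag_def)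
  ultimately have "\<infinity> \<le> (\<Sum>(i, j)\<in>offdiag. chi_integrand H i j x)"
    using member_le_sum[of "(i, j)" offdiag "\<lambda>(i, j). chi_integrand H i j x"] by simp
  then show ?thesis by (simp add: top_unique)
qed

lemma norm_eq_sum_shifted: "(norm x)\<^sup>2 = (\<Sum>i\<in>UNIV. (1 + g i \<bullet> x)\<^sup>2) - d"
  by (simp add: norm_eq_sum_gam power2_sum sum.distrib sum_gam_inner d_def flip: sum_distrib_left)

text \<open>On the boundary of the simplex the right side is infinite; inside, |x|^2 = S - d turns
  this into \<open>simplex_inequality\<close>.\<close>

lemma norm_le_sum_chi:
  assumes "x \<in> Xd H"
  shows "ennreal ((d + 2 * s) * (norm x)\<^sup>2) \<le> (\<Sum>(i, j)\<in>offdiag. chi_integrand H i j x)"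
proof (cases "\<exists>i. 1 + g i \<bullet> x = 0")
  case True
  then obtain i where "1 + g i \<bullet> x = 0" ..
  from sum_chi_integrand_top[OF this] show ?thesis by (simp only: top_greatest infinity_ennreal_def)
next
  case False
  then have pos: "0 < 1 + g i \<bullet> x" for i
    using assms by (auto simp: Xd_def less_le)
  show ?thesis
    unfolding sum_chi_integrand[OF pos] norm_eq_sum_shifted
    using simplex_inequality(1)[of UNIV "\<lambda>i. 1 + g i \<bullet> x"] pos card3 unfolding s_def d_def
    by (intro ennreal_leI) (simp add: sum.distrib sum_gam_inner mult.commute)
qed

text \<open>Turns the equality case into a location: the finite upper bound excludes the boundary,
  and the values gamma_i . x determine x.\<close>

lemma norm_eq_sum_chi:
  assumes "x \<in> Xd H"
    and le: "(\<Sum>(i, j)\<in>offdiag. chi_integrand H i j x) \<le> ennreal ((d + 2 * s) * (norm x)\<^sup>2)"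
  shows "x = 0 \<or> (\<exists>k. x = t *\<^sub>R g k)"
proof -
  let ?z = "\<lambda>i. 1 + g i \<bullet> x"
  have "?z i \<noteq> 0" for i
  proof
    assume "?z i = 0"
    from sum_chi_integrand_top[OF this] le show False by (simp only: infinity_ennreal_def top_unique) simp
  qed
  then have pos: "0 < ?z i" for i
    using assms by (auto simp: Xd_def less_le)
  have nn: "0 \<le> (d + 2 * s) * (norm x)\<^sup>2"
    using s_gt_1 d_pos by (intro mult_nonneg_nonneg) auto
  have "(\<Sum>i\<in>UNIV. (?z i)\<^sup>2) * (\<Sum>i\<in>UNIV. 1 / ?z i) - d\<^sup>2 \<le> ((\<Sum>i\<in>UNIV. (?z i)\<^sup>2) - d) * (d + 2 * s)"
    using le nn unfolding sum_chi_integrand[OF pos]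
    by (simp add: ennreal_le_iff norm_eq_sum_shifted mult.commute)
  then have "(\<forall>i. ?z i = 1) \<or> (\<exists>k. ?z k = d / (1 + s) \<and> (\<forall>i\<in>UNIV - {k}. ?z i = d / (s * (1 + s))))"
    using simplex_inequality[of UNIV ?z] pos card3 unfolding s_def d_def
    by (simp add: sum.distrib sum_gam_inner)
  then show ?thesis
  proof
    assume "\<forall>i. ?z i = 1"
    then show ?thesis by (auto intro: gam_eqI)
  next
    assume "\<exists>k. ?z k = d / (1 + s) \<and> (\<forall>i\<in>UNIV - {k}. ?z i = d / (s * (1 + s)))"
    then obtain k where "?z k = d / (1 + s)" "\<forall>i\<in>UNIV - {k}. ?z i = d / (s * (1 + s))"
      by auto
    then have "?z i = 1 + g i \<bullet> (t *\<^sub>R g k)" for i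
      unfolding gam_atom by simp
    then show ?thesis by (metis add_left_cancel gam_eqI)
  qed
qed

end

section \<open>Auxiliary facts on finite support, finite sums and extended reals\<close>

lemma integral_finite_support:
  fixes f :: "'a::t2_space \<Rightarrow> 'b::{banach, second_countable_topology}"
  assumes M: "finite_measure M" "sets M = sets borel"
    and F: "finite F" "AE x in M. x \<in> F" and f: "f \<in> borel_measurable borel"
  shows "integral\<^sup>L M f = (\<Sum>y\<in>F. measure M {y} *\<^sub>R f y)"
proof -
  interpret finite_measure M by fact
  have [measurable_cong]: "sets M = sets borel" by fact
  note f[measurable]
  have sp: "space M = UNIV" using sets_eq_imp_space_eq[OF M(2)] by simp
  have [measurable]: "{y} \<in> sets M" for y by (simp add: M(2))
  have "integral\<^sup>L M f = (\<integral>x. (\<Sum>y\<in>F. indicator {y} x *\<^sub>R f y) \<partial>M)"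
  proof (rule integral_cong_AE)
    show "AE x in M. f x = (\<Sum>y\<in>F. indicator {y} x *\<^sub>R f y)"
      using F(2)
    proof eventually_elim
      case (elim x)
      have "(\<Sum>y\<in>F. indicator {y} x *\<^sub>R f y) = (\<Sum>y\<in>F. if x = y then f y else 0)"
        by (intro sum.cong) (auto simp: indicator_def)
      then show ?case using elim F(1) by simp
    qed
  qed measurable
  also have "\<dots> = (\<Sum>y\<in>F. \<integral>x. indicator {y} x *\<^sub>R f y \<partial>M)"
    by (intro Bochner_Integration.integral_sum integrable_scaleR_left integrable_real_indicator)
       (auto simp: M(2) less_top[symmetric])
  also have "\<dots> = (\<Sum>y\<in>F. measure M {y} *\<^sub>R f y)"
    by (intro sum.cong refl, subst integral_scaleR_left) (auto simp: sp M(2) less_top[symmetric])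
  finally show ?thesis .
qed

lemma sum_option: "(\<Sum>a\<in>UNIV. f a) = f None + (\<Sum>k\<in>UNIV. f (Some k))"
  for f :: "'n::finite option \<Rightarrow> 'b::comm_monoid_add"
  by (simp add: UNIV_option_conv sum.reindex)

lemma ennreal_le_divide_mult:
  fixes a b :: real
  assumes "0 < a" "0 < b" "ennreal (a * u) \<le> ennreal b * x"
  shows "ennreal u \<le> ennreal (b / a) * x"
proof (cases x)
  case (real r)
  then have "a * u \<le> b * r" using assms
    by (simp add: ennreal_le_iff flip: ennreal_mult)
  then show ?thesis using assms real
    by (simp add: ennreal_mult[symmetric] ennreal_leI pos_le_divide_eq mult.commute)
next
  case top
  then show ?thesis using assms by (simp add: ennreal_mult_top)
qed

section \<open>The trace bound for anchored laws and the shape of extremal laws\<close>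

context simplex_frame
begin

text \<open>\<open>K_d d\<close> written with \<open>s\<close>: the number d (d - 1) of ordered
  pairs over the constant d + 2 s of the pointwise bound.\<close>

abbreviation avg_K :: real where "avg_K \<equiv> d * (d - 1) / (d + 2 * s)"

lemma Xd_borel [measurable]: "Xd H \<in> sets borel"
  unfolding Xd_def by measurable

text \<open>Nonnegative coordinates with sum d are at most d, so their squares sum to at most d^2.
  This boundedness supplies integrable second moments for every anchored law.\<close>

lemma Xd_norm_le: assumes "x \<in> Xd H" shows "norm x \<le> d"
proof -
  define z where "z i = 1 + g i \<bullet> x" for i
  have z: "0 \<le> z i" for i using assms by (simp add: Xd_def z_def)
  have sz: "sum z UNIV = d" by (simp add: z_def sum.distrib sum_gam_inner d_def)
  have "z i \<le> d" for i using member_le_sum[of i UNIV z] z sz by simp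
  then have "(\<Sum>i\<in>UNIV. (z i)\<^sup>2) \<le> (\<Sum>i\<in>UNIV. d * z i)"
    using z by (intro sum_mono) (simp add: power2_eq_square mult_right_mono)
  also have "\<dots> = d\<^sup>2" by (simp add: sz power2_eq_square flip: sum_distrib_left)
  finally have "(norm x)\<^sup>2 \<le> d\<^sup>2" using d_pos by (simp add: norm_eq_sum_shifted z_def)
  then show ?thesis using d_pos by (simp add: power2_le_iff_abs_le)
qed

lemma chi_integrand_borel [measurable]: "chi_integrand H i j \<in> borel_measurable borel"
  unfolding chi_integrand_def by measurable

context
  fixes \<rho> assumes \<rho>: "\<rho> \<in> anchored H"
begin

lemma prob_anchored: "prob_space \<rho>" using \<rho> by (simp add: anchored_def)

interpretation prob_space \<rho> by (rule prob_anchored)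

lemma sets_anchored [measurable_cong]: "sets \<rho> = sets borel" using \<rho> by (simp add: anchored_def)

lemma AE_Xd: "AE x in \<rho>. x \<in> Xd H"
proof (subst AE_in_set_eq_1)
  show "prob (Xd H) = 1" using \<rho> by (simp add: anchored_def measure_def)
qed measurable

lemma trace_Sigma_eq: "trace (Sigma_mat \<rho>) = (\<integral>x. (norm x)\<^sup>2 \<partial>\<rho>)"
proof -
  have "integrable \<rho> (\<lambda>x. x $ a * x $ a)" for a
  proof (rule integrable_const_bound)
    show "AE x in \<rho>. norm (x $ a * x $ a) \<le> d * d"
      using AE_Xd
    proof eventually_elim
      case (elim x)
      then have "\<bar>x $ a\<bar> \<le> d" using Xd_norm_le component_le_norm_cart order_trans by blast
      then have "\<bar>x $ a\<bar> * \<bar>x $ a\<bar> \<le> d * d" using d_pos by (intro mult_mono) auto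
      then show ?case by simp
    qed
  qed measurable
  then show ?thesis
    by (simp add: trace_def Sigma_mat_def power2_norm_eq_inner inner_vec_def
        Bochner_Integration.integral_sum)
qed

lemma nn_integral_norm:
  "(\<integral>\<^sup>+x. ennreal ((d + 2 * s) * (norm x)\<^sup>2) \<partial>\<rho>) = ennreal ((d + 2 * s) * trace (Sigma_mat \<rho>))"
proof -
  have int: "integrable \<rho> (\<lambda>x. (norm x)\<^sup>2)"
  proof (rule integrable_const_bound)
    show "AE x in \<rho>. norm ((norm x)\<^sup>2) \<le> d\<^sup>2"
      using AE_Xd by eventually_elim (simp add: Xd_norm_le power_mono)
  qed measurable
  show ?thesis
    unfolding trace_Sigma_eq using d_pos s_gt_1 int
    by (subst nn_integral_eq_integral) (auto intro!: mult_nonneg_nonneg)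
qed

lemma nn_integral_chi_le:
  "(\<integral>\<^sup>+x. (\<Sum>(i, j)\<in>offdiag. chi_integrand H i j x) \<partial>\<rho>) \<le> ennreal (d * (d - 1)) * chi_star H \<rho>"
proof -
  let ?I = "\<lambda>(i, j). \<integral>\<^sup>+x. chi_integrand H i j x \<partial>\<rho>"
  have "(\<integral>\<^sup>+x. (\<Sum>(i, j)\<in>offdiag. chi_integrand H i j x) \<partial>\<rho>) = (\<Sum>p\<in>offdiag. ?I p)"
    unfolding case_prod_unfold by (rule nn_integral_sum) measurable
  also have "\<dots> \<le> of_nat (card (offdiag :: ('n \<times> 'n) set)) * chi_star H \<rho>"
  proof (rule sum_bounded_above)
    have "{\<integral>\<^sup>+x. chi_integrand H i j x \<partial>\<rho> |i j. i \<noteq> j} = ?I ` offdiag"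
      by (auto simp: offdiag_def image_iff)
    then show "?I p \<le> chi_star H \<rho>" if "p \<in> offdiag" for p
      using that unfolding chi_star_def by (intro Max_ge) auto
  qed
  finally show ?thesis
    by (simp add: ennreal_of_nat_eq_real_of_nat card_offdiag d_def)
qed

lemma trace_le_chi_star: "ennreal (trace (Sigma_mat \<rho>)) \<le> ennreal avg_K * chi_star H \<rho>"
proof (rule ennreal_le_divide_mult)
  have "ennreal ((d + 2 * s) * trace (Sigma_mat \<rho>))
      \<le> (\<integral>\<^sup>+x. (\<Sum>(i, j)\<in>offdiag. chi_integrand H i j x) \<partial>\<rho>)"
    unfolding nn_integral_norm[symmetric]
    by (rule nn_integral_mono_AE) (use AE_Xd in eventually_elim, rule norm_le_sum_chi)
  also note nn_integral_chi_le
  finally show "ennreal ((d + 2 * s) * trace (Sigma_mat \<rho>)) \<le> ennreal (d * (d - 1)) * chi_star H \<rho>" .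
  show "0 < d + 2 * s" "0 < d * (d - 1)" using d_pos s_gt_1 d_eq by auto
qed

text \<open>When the trace bound is attained, the integrals of \<open>?f\<close> \<le>
  \<open>?h\<close> are forced to coincide, so the two agree almost everywhere and
  \<open>norm_eq_sum_chi\<close> locates the mass.\<close>

lemma extremal_support:
  assumes C: "0 \<le> C" "chi_star H \<rho> \<le> ennreal C" and tr: "trace (Sigma_mat \<rho>) = avg_K * C"
  shows "AE x in \<rho>. x \<in> insert 0 (range (\<lambda>k. t *\<^sub>R g k))"
proof -
  let ?f = "\<lambda>x. ennreal ((d + 2 * s) * (norm x)\<^sup>2)"
  let ?h = "\<lambda>x. \<Sum>(i, j)\<in>offdiag. chi_integrand H i j x"
  have [measurable]: "?h \<in> borel_measurable \<rho>" unfolding case_prod_unfold by measurable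
  have "(\<integral>\<^sup>+x. ?h x \<partial>\<rho>) \<le> ennreal (d * (d - 1)) * ennreal C"
    using nn_integral_chi_le C(2) by (meson mult_left_mono order_trans zero_le)
  also have "\<dots> = (\<integral>\<^sup>+x. ?f x \<partial>\<rho>)"
    using d_pos s_gt_1 d_eq C(1) unfolding nn_integral_norm tr
    by (simp add: ennreal_mult[symmetric])
  finally have *: "\<not> (\<integral>\<^sup>+x. ?f x \<partial>\<rho>) < (\<integral>\<^sup>+x. ?h x \<partial>\<rho>)" by simp
  have AE: "AE x in \<rho>. ?f x \<le> ?h x"
    using AE_Xd by eventually_elim (rule norm_le_sum_chi)
  \<comment> \<open>Otherwise the integral of \<open>?f\<close>, being finite, would be strictly
    smaller.\<close>
  have "AE x in \<rho>. ?h x \<le> ?f x"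
  proof (rule ccontr)
    assume "\<not> (AE x in \<rho>. ?h x \<le> ?f x)"
    then have "(\<integral>\<^sup>+x. ?f x \<partial>\<rho>) < (\<integral>\<^sup>+x. ?h x \<partial>\<rho>)"
      by (intro nn_integral_less AE) (simp_all only: nn_integral_norm ennreal_neq_top infinity_ennreal_def not_False_eq_True, measurable)
    with * show False by blast
  qed
  with AE_Xd show ?thesis
    by eventually_elim (use norm_eq_sum_chi in blast)
qed

lemma integral_extremal:
  fixes f :: "real^'m \<Rightarrow> 'b::{banach, second_countable_topology}"
  assumes "AE x in \<rho>. x \<in> insert 0 (range (\<lambda>k. t *\<^sub>R g k))" and "f \<in> borel_measurable borel"
  shows "integral\<^sup>L \<rho> f = prob {0} *\<^sub>R f 0 + (\<Sum>k\<in>UNIV. prob {t *\<^sub>R g k} *\<^sub>R f (t *\<^sub>R g k))"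
proof -
  have d1: "1 < d" using d_eq s_gt_1 by simp
  \<comment> \<open>Masses are summed per index, so the d + 1 atoms must be distinct: the t gamma_k
    from 0, then from one another.\<close>
  have "g i \<noteq> 0" for i using norm_gam[of i] d1 by auto
  then have "0 \<notin> range (\<lambda>k. t *\<^sub>R g k)" using t_pos by auto
  moreover have "inj (\<lambda>k. t *\<^sub>R g k)"
  proof
    fix i k assume "t *\<^sub>R g i = t *\<^sub>R g k"
    then have "g i \<bullet> g i = g i \<bullet> g k" using t_pos by simp
    then show "i = k" by (simp add: gam_inner_gam split: if_splits)
  qed
  ultimately show ?thesis
    by (simp add: integral_finite_support[OF _ sets_anchored _ assms] finite_measure_axioms
        sum.reindex)
qed

text \<open>Three moments determine the masses of the atoms: the zero mean makes the weights at the
  t gamma_k equal, the trace fixes their total as \<open>q\<close>, and total mass 1 leaves 1 - q at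
  the origin.\<close>

lemma extremal_prob:
  assumes C: "0 \<le> C" "chi_star H \<rho> \<le> ennreal C" and tr: "trace (Sigma_mat \<rho>) = avg_K * C"
    and A: "A \<in> sets borel"
  defines "q \<equiv> avg_K * C / (t\<^sup>2 * (1 - 1 / d))"
  shows "prob A = (1 - q) * indicator A 0 + q / d * (\<Sum>k\<in>UNIV. indicator A (t *\<^sub>R g k))"
proof -
  note int = integral_extremal[OF extremal_support[OF C tr]]
  have d1: "1 < d" using d_eq s_gt_1 by simp
  define w where "w k = prob {t *\<^sub>R g k}" for k
  define r where "r = sum w UNIV"
  have "(\<Sum>k\<in>UNIV. w k *\<^sub>R (t *\<^sub>R g k)) = 0"
    using int[of "\<lambda>x. x"] \<rho> by (simp add: anchored_def w_def)
  \<comment> \<open>Testing the mean against gamma_i isolates w_i, since gamma_i . gamma_k is a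
    Kronecker delta minus 1 / d.\<close>
  then have "g i \<bullet> (\<Sum>k\<in>UNIV. w k *\<^sub>R (t *\<^sub>R g k)) = 0" for i by simp
  then have "(\<Sum>k\<in>UNIV. w k * (t * ((if i = k then 1 else 0) - 1 / d))) = 0" for i
    by (simp add: inner_sum_right gam_inner_gam mult.assoc)
  moreover have "w k * (t * ((if i = k then 1 else 0) - 1 / d))
      = t * ((if i = k then w k else 0) - w k / d)" for i k
    by (simp add: algebra_simps)
  ultimately have "t * (\<Sum>k\<in>UNIV. (if i = k then w k else 0) - w k / d) = 0" for i
    by (simp only: sum_distrib_left)
  moreover have "(\<Sum>k\<in>UNIV. (if i = k then w k else 0) - w k / d) = w i - r / d" for i
    by (simp add: sum_subtractf r_def flip: sum_divide_distrib)
  ultimately have w: "w i = r / d" for i using t_pos by simp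
  have "avg_K * C = (\<Sum>k\<in>UNIV. w k * (t\<^sup>2 * (1 - 1 / d)))"
    using int[of "\<lambda>x. (norm x)\<^sup>2"] tr
    by (simp add: trace_Sigma_eq power_mult_distrib norm_gam w_def)
  also have "\<dots> = r * (t\<^sup>2 * (1 - 1 / d))" by (simp add: r_def sum_distrib_right)
  finally have r: "r = q" using t_pos d1 by (simp add: q_def)
  have "prob {0} + r = 1"
    using int[of "\<lambda>x. 1 :: real"] by (simp add: r_def w_def prob_space)
  then have 0: "prob {0} = 1 - q" using r by simp
  have "prob A = (\<integral>x. indicator A x \<partial>\<rho>)"
    using A sets_eq_imp_space_eq[OF sets_anchored] by simp
  also have "\<dots> = (1 - q) * indicator A 0 + q / d * (\<Sum>k\<in>UNIV. indicator A (t *\<^sub>R g k))"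
    using A w by (subst int) (simp_all add: 0 w_def[symmetric] r sum_distrib_left)
  finally show ?thesis .
qed

end

text \<open>\<open>extremal_prob\<close> expresses all probabilities through C, d, s and t alone, so
  any two extremal laws agree on Borel sets.\<close>

lemma extremal_unique:
  assumes "0 \<le> C"
    and "\<rho> \<in> anchored H" "chi_star H \<rho> \<le> ennreal C" "trace (Sigma_mat \<rho>) = avg_K * C"
    and "\<rho>' \<in> anchored H" "chi_star H \<rho>' \<le> ennreal C" "trace (Sigma_mat \<rho>') = avg_K * C"
  shows "\<rho> = \<rho>'"
proof (rule measure_eqI)
  show "sets \<rho> = sets \<rho>'" using assms by (simp add: anchored_def)
  interpret R: prob_space \<rho> using assms by (simp add: anchored_def)
  interpret R': prob_space \<rho>' using assms by (simp add: anchored_def)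
  fix A assume "A \<in> sets \<rho>"
  then have "A \<in> sets borel" using assms by (simp add: anchored_def)
  then show "emeasure \<rho> A = emeasure \<rho>' A"
    using assms by (simp add: R.emeasure_eq_measure R'.emeasure_eq_measure extremal_prob)
qed

section \<open>Randomized response at \<open>lam_star\<close>: moments and budget\<close>

lemma C_star_eq: "C_star d = (s - 1)\<^sup>2 / s\<^sup>2"
proof -
  have "d + s - 1 = s * (s + 1)" using d_eq by (simp add: algebra_simps power2_eq_square)
  then show ?thesis
    using s_gt_1 by (simp add: C_star_def C1_def lam_star_def s_def[symmetric] power2_eq_square)
qed

lemma avg_K_eq: "avg_K = d * s\<^sup>2 / (s + 1)\<^sup>2"
proof -
  have "d + 2 * s = (s + 1)\<^sup>2" "d - 1 = s\<^sup>2" using d_eq by (simp_all add: power2_sum)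
  then show ?thesis by simp
qed

context
  fixes p :: real assumes p: "0 \<le> p" "p \<le> 1"
begin

abbreviation \<rho>0 where "\<rho>0 \<equiv> rho_rr H p (lam_star d)"

text \<open>\<open>None\<close> indexes the atom at 0 and \<open>Some k\<close> the atom t gamma_k,
  so that the law becomes the image of a weighted finite set.\<close>

definition rr_weight :: "'n option \<Rightarrow> real" where
  "rr_weight = case_option (1 - p) (\<lambda>_. p / d)"

definition rr_atom :: "'n option \<Rightarrow> real^'m" where
  "rr_atom = case_option 0 (\<lambda>k. t *\<^sub>R g k)"

lemma rr_weight_nonneg: "0 \<le> rr_weight a"
  using p d_pos by (auto simp: rr_weight_def split: option.split)

lemma rr_atom_measurable: "rr_atom \<in> point_measure UNIV rr_weight \<rightarrow>\<^sub>M borel"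
  by (simp add: measurable_def sets_point_measure space_point_measure)

lemma nn_integral_distr_rr:
  assumes "f \<in> borel_measurable borel"
  shows "integral\<^sup>N (distr (point_measure UNIV rr_weight) borel rr_atom) f
    = ennreal (1 - p) * f 0 + ennreal (p / d) * (\<Sum>k\<in>UNIV. f (t *\<^sub>R g k))"
  using assms by (simp add: nn_integral_distr rr_atom_measurable nn_integral_point_measure_finite
      sum_option sum_distrib_left) (simp add: rr_weight_def rr_atom_def)

text \<open>\<open>measure_of\<close> returns the given set function only where that is a measure;
  comparison with an image measure supplies countable additivity and the integration rules.\<close>

lemma rho_rr_eq_distr: "\<rho>0 = distr (point_measure UNIV rr_weight) borel rr_atom" (is "_ = ?N")
proof -
  have "\<rho>0 = measure_of UNIV (sets borel) (emeasure ?N)"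
    unfolding rho_rr_def d_def[symmetric] t_def[symmetric]
  proof (rule measure_of_eq)
    fix A :: "(real^'m) set" assume "A \<in> sigma_sets UNIV (sets borel)"
    then have "A \<in> sets borel" by (metis sets.sigma_sets_eq space_borel)
    then show "ennreal (1 - p) * indicator A 0 +
        ennreal (p / d) * (\<Sum>i\<in>UNIV. indicator A (t *\<^sub>R g i)) = emeasure ?N A"
      using nn_integral_distr_rr[of "indicator A"] by simp
  qed simp
  also have "\<dots> = ?N" using measure_of_of_measure[of ?N] by simp
  finally show ?thesis .
qed

lemmas nn_integral_rr = nn_integral_distr_rr[folded rho_rr_eq_distr]

lemma integral_rr:
  fixes f :: "real^'m \<Rightarrow> 'b::{banach, second_countable_topology}"
  assumes "f \<in> borel_measurable borel"
  shows "integrable \<rho>0 f"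
    and "integral\<^sup>L \<rho>0 f = (1 - p) *\<^sub>R f 0 + (p / d) *\<^sub>R (\<Sum>k\<in>UNIV. f (t *\<^sub>R g k))"
proof -
  show "integrable \<rho>0 f"
    unfolding rho_rr_eq_distr integrable_distr_eq[OF rr_atom_measurable assms]
    by (rule integrable_point_measure_finite) simp
  show "integral\<^sup>L \<rho>0 f = (1 - p) *\<^sub>R f 0 + (p / d) *\<^sub>R (\<Sum>k\<in>UNIV. f (t *\<^sub>R g k))"
    unfolding rho_rr_eq_distr integral_distr[OF rr_atom_measurable assms]
    by (simp add: lebesgue_integral_point_measure_finite rr_weight_nonneg sum_option scaleR_sum_right)
      (simp add: rr_weight_def rr_atom_def)
qed

lemma rr_anchored: "\<rho>0 \<in> anchored H"
proof -
  have sets: "sets \<rho>0 = sets borel" by (simp add: rho_rr_eq_distr)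
  have em: "emeasure \<rho>0 A = ennreal (1 - p) * indicator A 0 +
      ennreal (p / d) * (\<Sum>k\<in>UNIV. indicator A (t *\<^sub>R g k))" if "A \<in> sets borel" for A
    using nn_integral_rr[of "indicator A"] that by (simp add: sets)
  \<comment> \<open>Any Borel set containing all atoms has mass 1; this serves both the whole space
    and \<open>Xd H\<close>.\<close>
  have one: "emeasure \<rho>0 A = 1" if "A \<in> sets borel" "0 \<in> A" "\<And>k. t *\<^sub>R g k \<in> A" for A
  proof -
    have "emeasure \<rho>0 A = ennreal (1 - p) + ennreal (p / d) * ennreal d"
      unfolding em[OF that(1)] using that by (simp add: d_def ennreal_of_nat_eq_real_of_nat)
    also have "\<dots> = ennreal (1 - p + p / d * d)"
      using p d_pos by (simp flip: ennreal_mult ennreal_plus)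
    finally show ?thesis using d_pos by simp
  qed
  have "prob_space \<rho>0"
    using one[of UNIV] sets_eq_imp_space_eq[OF sets] by (intro prob_spaceI) simp
  moreover have "emeasure \<rho>0 (Xd H) = 1"
    using less_imp_le[OF gam_atom_pos] by (intro one) (simp_all add: Xd_borel Xd_def)
  \<comment> \<open>A vector orthogonal to every x is 0; equal weights on the t gamma_k then give
    mean 0.\<close>
  moreover have "(\<Sum>k\<in>UNIV. g k) \<bullet> x = 0" for x
    by (simp add: inner_sum_left sum_gam_inner)
  then have "(\<Sum>k\<in>UNIV. g k) = 0" using inner_eq_zero_iff by blast
  then have "integral\<^sup>L \<rho>0 (\<lambda>x. x) = 0"
    by (simp add: integral_rr flip: scaleR_sum_right)
  ultimately show ?thesis
    by (simp add: anchored_def sets integral_rr)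
qed

lemma trace_rr: "trace (Sigma_mat \<rho>0) = avg_K * (p * C_star d)"
proof -
  have "trace (Sigma_mat \<rho>0) = p * (t\<^sup>2 * (1 - 1 / d))"
    using d_pos by (simp add: trace_Sigma_eq[OF rr_anchored] integral_rr power_mult_distrib norm_gam
        d_def[symmetric])
  also have "1 - 1 / d = s\<^sup>2 / d" using d_pos d_eq by (simp add: field_simps)
  also have "p * (t\<^sup>2 * (s\<^sup>2 / d)) = avg_K * (p * C_star d)"
  proof -
    \<comment> \<open>Both sides equal p d u^2 / v^2.\<close>
    define u v where "u = s - 1" and "v = s + 1"
    have "v \<noteq> 0" "s \<noteq> 0" "d \<noteq> 0" using s_gt_1 d_pos by (auto simp: v_def)
    then show ?thesis
      unfolding avg_K_eq C_star_eq t_eq u_def[symmetric] v_def[symmetric]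
      by (simp add: field_simps power2_eq_square)
  qed
  finally show ?thesis .
qed

lemma chi_integral_rr:
  assumes "i \<noteq> j"
  shows "(\<integral>\<^sup>+x. chi_integrand H i j x \<partial>\<rho>0) = ennreal (p * C_star d)"
proof -
  define z where "z k l = 1 + g l \<bullet> (t *\<^sub>R g k)" for k l
  have z: "0 < z k l" for k l unfolding z_def by (rule gam_atom_pos)
  have "chi_integrand H i j (t *\<^sub>R g k) = ennreal ((z k j - z k i)\<^sup>2 / z k i)" for k
    using z[of k i] by (simp add: chi_integrand_def z_def inner_diff_left right_diff_distrib)
  then have "(\<Sum>k\<in>UNIV. chi_integrand H i j (t *\<^sub>R g k))
      = ennreal (\<Sum>k\<in>UNIV. (z k j - z k i)\<^sup>2 / z k i)"
    using z by (simp add: less_imp_le)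
  \<comment> \<open>For k distinct from i and j, coordinates i and j of t gamma_k agree, so only the
    atoms k = i and k = j contribute.\<close>
  also have "(\<Sum>k\<in>UNIV. (z k j - z k i)\<^sup>2 / z k i) = (\<Sum>k\<in>{i, j}. (z k j - z k i)\<^sup>2 / z k i)"
    unfolding z_def gam_atom by (rule sum.mono_neutral_right) auto
  also have "\<dots> = d * C_star d"
  proof -
    have "s \<noteq> 0" "1 + s \<noteq> 0" using s_gt_1 by auto
    then show ?thesis
      unfolding C_star_eq z_def gam_atom using assms d_pos
      by (simp add: divide_simps) (simp add: algebra_simps power2_eq_square)
  qed
  finally have "(\<integral>\<^sup>+x. chi_integrand H i j x \<partial>\<rho>0) = ennreal (p / d) * ennreal (d * C_star d)"
    by (simp add: nn_integral_rr chi_integrand_borel) (simp add: chi_integrand_def)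
  then show ?thesis using p d_pos by (simp add: C_star_eq flip: ennreal_mult)
qed

lemma chi_star_rr: "chi_star H \<rho>0 = ennreal (p * C_star d)"
proof -
  have "1 < CARD('n)" using card3 by simp
  then obtain i j :: 'n where "i \<noteq> j"
    by (metis UNIV_I card_le_Suc0_iff_eq finite linorder_not_less One_nat_def)
  have "{\<integral>\<^sup>+x. chi_integrand H i j x \<partial>\<rho>0 |i j. i \<noteq> j} = {ennreal (p * C_star d)}"
  proof (intro equalityI subsetI)
    fix c assume "c \<in> {ennreal (p * C_star d)}"
    then have "c = (\<integral>\<^sup>+x. chi_integrand H i j x \<partial>\<rho>0)"
      using chi_integral_rr[OF \<open>i \<noteq> j\<close>] by simp
    then show "c \<in> {\<integral>\<^sup>+x. chi_integrand H i j x \<partial>\<rho>0 |i j. i \<noteq> j}"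
      using \<open>i \<noteq> j\<close> by blast
  qed (auto simp: chi_integral_rr)
  then show ?thesis by (simp add: chi_star_def)
qed

end

end

section \<open>Sharpness of the trace bound and uniqueness of its maximiser\<close>

theorem theorem7p5:
  fixes H :: "real^'m^'n"
  assumes d3: "CARD('n) \<ge> 3"
    and dm: "CARD('m) + 1 = CARD('n)"
    and H: "valid_H H"
  shows "(\<forall>\<rho>\<in>anchored H.
            ennreal (trace (Sigma_mat \<rho>)) \<le> ennreal (K_d (real CARD('n))) * chi_star H \<rho>)
   \<and> (\<forall>C::real. C \<ge> 0 \<longrightarrow>
         (SUP \<rho>\<in>{\<rho>\<in>anchored H. chi_star H \<rho> \<le> ennreal C}. ereal (trace (Sigma_mat \<rho>)))
            \<le> ereal (K_d (real CARD('n)) * C))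
   \<and> (\<forall>C::real. 0 \<le> C \<and> C \<le> C_star (real CARD('n)) \<longrightarrow>
        (let p = C / C_star (real CARD('n));
             \<rho>0 = rho_rr H p (lam_star (real CARD('n)))
         in \<rho>0 \<in> anchored H \<and> chi_star H \<rho>0 \<le> ennreal C
            \<and> trace (Sigma_mat \<rho>0) = K_d (real CARD('n)) * C
            \<and> (\<forall>\<rho>\<in>anchored H. chi_star H \<rho> \<le> ennreal C
                  \<and> trace (Sigma_mat \<rho>) = K_d (real CARD('n)) * C \<longrightarrow> \<rho> = \<rho>0)))"
proof -
  define d where "d = real CARD('n)"
  interpret simplex_frame H d "sqrt (d - 1)" "t_lam d (lam_star d)"
    by unfold_locales (use d3 H in \<open>simp_all add: d_def\<close>)
  have K: "K_d d = avg_K" by (simp add: K_d_def)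
  have K0: "0 \<le> K_d d" using d3 by (simp add: K_d_def d_def)
  have bound: "ennreal (trace (Sigma_mat \<rho>)) \<le> ennreal (K_d d) * chi_star H \<rho>"
    if "\<rho> \<in> anchored H" for \<rho>
    using trace_le_chi_star[OF that] unfolding K .
  have sup: "trace (Sigma_mat \<rho>) \<le> K_d d * C"
    if "0 \<le> C" "\<rho> \<in> anchored H" "chi_star H \<rho> \<le> ennreal C" for \<rho> C
  proof -
    have "ennreal (trace (Sigma_mat \<rho>)) \<le> ennreal (K_d d) * ennreal C"
      using bound[OF that(2)] mult_left_mono[OF that(3)] by (rule order_trans) simp
    \<comment> \<open>\<open>ennreal\<close> truncates negative reals at 0, so the return to real
      numbers relies on \<open>K_d d * C\<close> being nonnegative.\<close>
    then show ?thesis using K0 that(1) by (simp add: ennreal_le_iff flip: ennreal_mult)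
  qed
  have attained: "rho_rr H (C / C_star d) (lam_star d) \<in> anchored H"
      "chi_star H (rho_rr H (C / C_star d) (lam_star d)) = ennreal C"
      "trace (Sigma_mat (rho_rr H (C / C_star d) (lam_star d))) = K_d d * C"
    if "0 \<le> C" "C \<le> C_star d" for C
  proof -
    \<comment> \<open>Since s > 1, \<open>C_star d\<close> is positive; thus p = C /
      \<open>C_star d\<close> lies in [0, 1] and p times \<open>C_star d\<close> is C.\<close>
    have pos: "0 < C_star d" using s_gt_1 by (simp add: C_star_eq)
    then have p: "0 \<le> C / C_star d" "C / C_star d \<le> 1" using that by auto
    show "rho_rr H (C / C_star d) (lam_star d) \<in> anchored H" by (rule rr_anchored[OF p])
    show "chi_star H (rho_rr H (C / C_star d) (lam_star d)) = ennreal C"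
      using chi_star_rr[OF p] pos by simp
    show "trace (Sigma_mat (rho_rr H (C / C_star d) (lam_star d))) = K_d d * C"
      using trace_rr[OF p] pos unfolding K by simp
  qed
  show ?thesis
    unfolding d_def[symmetric] Let_def
  proof (intro conjI ballI allI impI; (elim conjE)?)
    \<comment> \<open>The response law is itself extremal for the same C, so uniqueness is a
      comparison of two extremal laws.\<close>
    fix C \<rho> assume "0 \<le> C" "C \<le> C_star d" "\<rho> \<in> anchored H" "chi_star H \<rho> \<le> ennreal C"
      "trace (Sigma_mat \<rho>) = K_d d * C"
    then show "\<rho> = rho_rr H (C / C_star d) (lam_star d)"
      using attained[of C] unfolding K by (intro extremal_unique[of C]) simp_all
  qed (auto simp: bound sup attained intro!: SUP_least)
qed

end
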